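(* Let $f(q)=\sum_{n=0}^\infty q^na_n$ be slice regular on $\overline{\mathbb B}$ with $f'(0)=1$. Then there exists $u\in\partial\mathbb B$ such that the image $\widetilde f_u(\mathbb B)$ of $\mathbb B$ under the slice regular rotation $$\widetilde f_u(q)=\sum_{n=0}^\infty q^nu^na_n$$ of $f$ contains an open ball of radius $5/2-\sqrt6$.
   Context: $\mathbb H$ is the skew field of quaternions, $|\cdot|$ its Euclidean norm, $\mathbb S=\{q\in\mathbb H:q^2=-1\}$. For $I\in\mathbb S$, $\mathbb C_I=\mathbb R+\mathbb R I$, and for $\Omega\subset\mathbb H$, $\Omega_I=\Omega\cap\mathbb C_I$. An open ball in $\mathbb H$ is a set $B(q_0,R)=\{q\in\mathbb H:|q-q_0|<R\}$; $\mathbb B=B(0,1)$, with closure $\overline{\mathbb B}$ and boundary $\partial\mathbb B$. A function $f:\Omega\to\mathbb H$ on a domain $\Omega\subset\mathbb H$ is slice regular if for every $I\in\mathbb S$ its restriction $f_I$ to $\Omega_I$ has continuous partial derivatives and satisfies $\frac12\big(\frac{\partial}{\partial x}+I\frac{\partial}{\partial y}\big)f_I(x+yI)=0$ for all $x+yI\in\Omega_I$. On an open ball $B(0,R)$ this is equivalent to $f(q)=\sum_{n\ge0}q^na_n$ with $a_n\in\mathbb H$, the series converging absolutely and uniformly on compact subsets of $B(0,R)$. "Slice regular on $\overline{\mathbb B}$" means slice regular on some ball $B(0,R)$ with $R>1$. The slice derivative is $f'(x+yI)=\frac12\big(\frac{\partial}{\partial x}-I\frac{\partial}{\partial y}\big)f_I(x+yI)$;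 equivalently $f'(q)=\sum_{n\ge1}q^{n-1}na_n$. *)

theory Defs
  imports "HOL-Analysis.Analysis"
begin

section \<open>The skew field of quaternions\<close>

datatype quat = Quat (q0: real) (q1: real) (q2: real) (q3: real)

lemma quat_eq_iff: "p = q \<longleftrightarrow> q0 p = q0 q \<and> q1 p = q1 q \<and> q2 p = q2 q \<and> q3 p = q3 q"
  by (cases p; cases q) auto

instantiation quat :: ab_group_add
begin

definition "0 = Quat 0 0 0 0"

definition "p + q = Quat (q0 p + q0 q) (q1 p + q1 q) (q2 p + q2 q) (q3 p + q3 q)"

definition "- q = Quat (- q0 q) (- q1 q) (- q2 q) (- q3 q)"

definition "p - q = Quat (q0 p - q0 q) (q1 p - q1 q) (q2 p - q2 q) (q3 p - q3 q)"

instance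
  by standard (simp_all add: quat_eq_iff zero_quat_def plus_quat_def uminus_quat_def minus_quat_def)

end

lemma quat_sel_add [simp]:
  "q0 (p + q) = q0 p + q0 q" "q1 (p + q) = q1 p + q1 q"
  "q2 (p + q) = q2 p + q2 q" "q3 (p + q) = q3 p + q3 q"
  by (simp_all add: plus_quat_def)

lemma quat_sel_diff [simp]:
  "q0 (p - q) = q0 p - q0 q" "q1 (p - q) = q1 p - q1 q"
  "q2 (p - q) = q2 p - q2 q" "q3 (p - q) = q3 p - q3 q"
  by (simp_all add: minus_quat_def)

lemma quat_sel_minus [simp]:
  "q0 (- q) = - q0 q" "q1 (- q) = - q1 q" "q2 (- q) = - q2 q" "q3 (- q) = - q3 q"
  by (simp_all add: uminus_quat_def)

lemma quat_sel_zero [simp]: "q0 0 = 0" "q1 0 = 0" "q2 0 = 0" "q3 0 = 0"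
  by (simp_all add: zero_quat_def)

instantiation quat :: ring_1
begin

definition "1 = Quat 1 0 0 0"

text \<open>The Hamilton product: \<open>i\<^sup>2 = j\<^sup>2 = k\<^sup>2 = i j k = -1\<close>.\<close>

definition "p * q = Quat
  (q0 p * q0 q - q1 p * q1 q - q2 p * q2 q - q3 p * q3 q)
  (q0 p * q1 q + q1 p * q0 q + q2 p * q3 q - q3 p * q2 q)
  (q0 p * q2 q - q1 p * q3 q + q2 p * q0 q + q3 p * q1 q)
  (q0 p * q3 q + q1 p * q2 q - q2 p * q1 q + q3 p * q0 q)"

instance
  by standard (simp_all add: quat_eq_iff one_quat_def times_quat_def algebra_simps)

end

lemma quat_sel_one [simp]: "q0 1 = 1" "q1 1 = 0" "q2 1 = 0" "q3 1 = 0"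
  by (simp_all add: one_quat_def)

lemma quat_sel_mult [simp]:
  "q0 (p * q) = q0 p * q0 q - q1 p * q1 q - q2 p * q2 q - q3 p * q3 q"
  "q1 (p * q) = q0 p * q1 q + q1 p * q0 q + q2 p * q3 q - q3 p * q2 q"
  "q2 (p * q) = q0 p * q2 q - q1 p * q3 q + q2 p * q0 q + q3 p * q1 q"
  "q3 (p * q) = q0 p * q3 q + q1 p * q2 q - q2 p * q1 q + q3 p * q0 q"
  by (simp_all add: times_quat_def)

instantiation quat :: real_algebra_1
begin

definition "scaleR r q = Quat (r * q0 q) (r * q1 q) (r * q2 q) (r * q3 q)"

instance
  by standard (simp_all add: quat_eq_iff scaleR_quat_def algebra_simps)

end

lemma quat_sel_scaleR [simp]:
  "q0 (r *\<^sub>R q) = r * q0 q" "q1 (r *\<^sub>R q) = r * q1 q"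
  "q2 (r *\<^sub>R q) = r * q2 q" "q3 (r *\<^sub>R q) = r * q3 q"
  by (simp_all add: scaleR_quat_def)

instantiation quat :: real_inner
begin

definition "inner p q = q0 p * q0 q + q1 p * q1 q + q2 p * q2 q + q3 p * q3 q"

definition "norm (q :: quat) = sqrt (inner q q)"

definition "dist p (q :: quat) = norm (p - q)"

definition "sgn (q :: quat) = q /\<^sub>R norm q"

definition [code del]: "(uniformity :: (quat \<times> quat) filter) = (INF e\<in>{0<..}. principal {(x, y). dist x y < e})"

definition [code del]: "open (U :: quat set) \<longleftrightarrow>
  (\<forall>x\<in>U. \<forall>\<^sub>F (x', y) in uniformity. x' = x \<longrightarrow> y \<in> U)"

instance
proof
  fix x :: quat
  show "inner x x \<ge> 0"
    by (simp add: inner_quat_def)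
  have "inner x x = (q0 x)\<^sup>2 + (q1 x)\<^sup>2 + (q2 x)\<^sup>2 + (q3 x)\<^sup>2"
    by (simp add: inner_quat_def power2_eq_square)
  then show "inner x x = 0 \<longleftrightarrow> x = 0"
    by (simp add: quat_eq_iff add_nonneg_eq_0_iff)
qed (simp_all add: dist_quat_def sgn_quat_def uniformity_quat_def open_quat_def
      norm_quat_def inner_quat_def algebra_simps)

end

lemma norm_quat: "norm q = sqrt ((q0 q)\<^sup>2 + (q1 q)\<^sup>2 + (q2 q)\<^sup>2 + (q3 q)\<^sup>2)"
  by (simp add: norm_quat_def inner_quat_def power2_eq_square)

instantiation quat :: real_normed_div_algebra
begin

definition "inverse q =
  Quat (q0 q) (- q1 q) (- q2 q) (- q3 q) /\<^sub>R ((q0 q)\<^sup>2 + (q1 q)\<^sup>2 + (q2 q)\<^sup>2 + (q3 q)\<^sup>2)"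

definition "divide (p :: quat) q = p * inverse q"

instance
proof
  fix x y :: quat
  let ?n = "(q0 x)\<^sup>2 + (q1 x)\<^sup>2 + (q2 x)\<^sup>2 + (q3 x)\<^sup>2"
  show "norm (x * y) = norm x * norm y"
    unfolding norm_quat real_sqrt_mult [symmetric]
    by (rule arg_cong [where f = sqrt]) (simp add: power2_eq_square algebra_simps)
  show "x div y = x * inverse y"
    by (simp add: divide_quat_def)
  show "inverse (0 :: quat) = 0"
    by (simp add: inverse_quat_def quat_eq_iff)
  assume "x \<noteq> 0"
  then have n: "?n \<noteq> 0"
    by (simp add: quat_eq_iff add_nonneg_eq_0_iff)
  let ?c = "Quat (q0 x) (- q1 x) (- q2 x) (- q3 x)"
  have "?c * x = ?n *\<^sub>R 1" "x * ?c = ?n *\<^sub>R 1"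
    by (simp_all add: quat_eq_iff power2_eq_square)
  then show "inverse x * x = 1" "x * inverse x = 1"
    using n by (simp_all add: inverse_quat_def)
qed

end

instantiation quat :: euclidean_space
begin

definition "Basis = {Quat 1 0 0 0, Quat 0 1 0 0, Quat 0 0 1 0, Quat 0 0 0 1}"

instance
proof
  fix u v x :: quat
  show "(Basis :: quat set) \<noteq> {}" "finite (Basis :: quat set)"
    by (simp_all add: Basis_quat_def)
  show "inner u v = (if u = v then 1 else 0)" if "u \<in> Basis" "v \<in> Basis"
    using that unfolding Basis_quat_def by (elim insertE emptyE) (simp_all add: inner_quat_def)
  show "(\<forall>u\<in>Basis. inner x u = 0) \<longleftrightarrow> x = 0"
    by (simp add: Basis_quat_def inner_quat_def quat_eq_iff [of x])
qed

end


section \<open>Slice regular functions\<close>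

definition imag_units :: "quat set"
  where "imag_units = {I. I\<^sup>2 = - 1}"

definition slice_point :: "quat \<Rightarrow> real \<Rightarrow> real \<Rightarrow> quat"
  where "slice_point I x y = of_real x + of_real y * I"

definition slice_dx :: "(quat \<Rightarrow> quat) \<Rightarrow> quat \<Rightarrow> real \<Rightarrow> real \<Rightarrow> quat"
  where "slice_dx f I x y = vector_derivative (\<lambda>t. f (slice_point I t y)) (at x)"

definition slice_dy :: "(quat \<Rightarrow> quat) \<Rightarrow> quat \<Rightarrow> real \<Rightarrow> real \<Rightarrow> quat"
  where "slice_dy f I x y = vector_derivative (\<lambda>t. f (slice_point I x t)) (at y)"

definition slice_regular_on :: "quat set \<Rightarrow> (quat \<Rightarrow> quat) \<Rightarrow> bool"
  where "slice_regular_on \<Omega> f \<longleftrightarrow> open \<Omega> \<and> connected \<Omega> \<and>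
    (\<forall>I\<in>imag_units.
      (\<forall>x y. slice_point I x y \<in> \<Omega> \<longrightarrow>
        (\<lambda>t. f (slice_point I t y)) differentiable at x \<and>
        (\<lambda>t. f (slice_point I x t)) differentiable at y) \<and>
      continuous_on {(x, y). slice_point I x y \<in> \<Omega>} (\<lambda>(x, y). slice_dx f I x y) \<and>
      continuous_on {(x, y). slice_point I x y \<in> \<Omega>} (\<lambda>(x, y). slice_dy f I x y) \<and>
      (\<forall>x y. slice_point I x y \<in> \<Omega> \<longrightarrow>
        (1 / 2) *\<^sub>R (slice_dx f I x y + I * slice_dy f I x y) = 0))"

text \<open>
  A point can be written as \<open>x + y I\<close> in more than one way: as \<open>x + (-y) (-I)\<close>, and, if it is
  real, with every imaginary unit \<open>I\<close>. For a slice regular function all these representations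
  yield the same value, so the description below is proper there; elsewhere it is unspecified.
\<close>

definition slice_deriv :: "(quat \<Rightarrow> quat) \<Rightarrow> quat \<Rightarrow> quat"
  where "slice_deriv f q = (THE d. \<forall>I\<in>imag_units. \<forall>x y. q = slice_point I x y \<longrightarrow>
    d = (1 / 2) *\<^sub>R (slice_dx f I x y - I * slice_dy f I x y))"

text \<open>The slice regular rotation by \<open>u\<close> of \<open>f(q) = \<Sum>n. q\<^sup>n a\<^sub>n\<close>, given by its coefficients.\<close>

definition slice_rotation :: "(nat \<Rightarrow> quat) \<Rightarrow> quat \<Rightarrow> quat \<Rightarrow> quat"
  where "slice_rotation a u q = (\<Sum>n. q ^ n * u ^ n * a n)"

end

theory Submission
  imports Defs "HOL-Complex_Analysis.Cauchy_Integral_Formula"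
begin

text \<open>
  Write \<open>D(q) = \<Sum>n. q\<^sup>n (n + 1) a\<^sub>n\<^sub>+\<^sub>1\<close> for the slice derivative of \<open>f\<close>, so that \<open>D(0) = a\<^sub>1 = 1\<close>, and
  let \<open>p\<close> maximise \<open>(1 - |q|) |D(q)|\<close> on the closed unit ball. With \<open>p = r u\<close>, where \<open>r = |p|\<close> and
  \<open>|u| = 1\<close>, and \<open>t = (1 - r) / 2\<close>, this gives \<open>t |D(p)| \<ge> 1/2\<close> and \<open>|D(q)| \<le> 2 |D(p)|\<close> for
  \<open>|q| \<le> r + t\<close> (\<open>exists_bloch_point\<close>).

  The rotation \<open>g\<close> of \<open>f\<close> by \<open>u\<close> satisfies \<open>g(q) = f(q u)\<close> and \<open>g'(q) = u D(q u)\<close> on every slice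
  that contains \<open>u\<close>. The rotation thus moves the extremal point \<open>p\<close> to the real point \<open>r\<close>. This is what
  makes the argument work: real numbers are central, so \<open>g\<close> can be expanded around \<open>r\<close> as
  \<open>g(r + y) = \<Sum>n. y\<^sup>n b\<^sub>n\<close> for \<^emph>\<open>all\<close> quaternions \<open>y\<close> with \<open>|y| + r < R\<close> (\<open>recenter_sums\<close>), with
  \<open>|b\<^sub>1| = |D(p)|\<close>. On such a slice the derivative of \<open>g\<close> is bounded by \<open>2 |b\<^sub>1|\<close> at distance \<open>t\<close> from
  \<open>r\<close>, so Cauchy's estimate on this single slice (\<open>slice_cauchy_estimate\<close>) yields
  \<open>|b\<^sub>n| \<le> 2 |b\<^sub>1| / t\<^sup>n\<^sup>-\<^sup>1\<close> for \<open>n \<ge> 1\<close>. Hence for \<open>|y| \<le> t x\<close> with \<open>0 < x < 1\<close> the distance of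
  \<open>g(r + y)\<close> from the affine map \<open>b\<^sub>0 + y b\<^sub>1\<close> is at most \<open>2 |b\<^sub>1| t x\<^sup>2 / (1 - x)\<close>, and Brouwer's fixed
  point theorem (\<open>ball_subset_image_near_linear\<close>) shows that the image of this ball contains the ball
  around \<open>g(r)\<close> of radius \<open>t |b\<^sub>1| (x - 2 x\<^sup>2 / (1 - x))\<close>. The best choice \<open>x = 1 - sqrt 6 / 3\<close> makes
  the last factor \<open>5 - 2 sqrt 6\<close>, and \<open>t |b\<^sub>1| \<ge> 1/2\<close> concludes.
\<close>

section \<open>Slices as copies of the complex plane\<close>

text \<open>
  The embedding \<open>x + y \<i> \<mapsto> x + y I\<close> of the complex numbers onto the slice of \<open>I\<close>. It is an isometric
  ring homomorphism when \<open>I\<close> is an imaginary unit, and every quaternion lies on such a slice.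
\<close>

definition slice_emb :: "quat \<Rightarrow> complex \<Rightarrow> quat"
  where "slice_emb I z = slice_point I (Re z) (Im z)"

lemma of_real_quat_sel [simp]:
  "q0 (of_real x) = x" "q1 (of_real x) = 0" "q2 (of_real x) = 0" "q3 (of_real x) = 0"
  by (simp_all add: of_real_def)

lemma imag_units_sq: "I \<in> imag_units \<Longrightarrow> I * I = - 1"
  by (simp add: imag_units_def power2_eq_square)

lemma imag_units_q0:
  assumes "I \<in> imag_units"
  shows "q0 I = 0"
proof (rule ccontr)
  assume "q0 I \<noteq> 0"
  moreover have "q1 (I * I) = 0" "q2 (I * I) = 0" "q3 (I * I) = 0" "q0 (I * I) = - 1"
    using imag_units_sq[OF assms] by simp_all
  ultimately have "q1 I = 0" "q2 I = 0" "q3 I = 0" "q0 I * q0 I = - 1"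
    by auto
  then show False
    using zero_le_square[of "q0 I"] by linarith
qed

lemma imag_units_norm: "I \<in> imag_units \<Longrightarrow> norm I = 1"
  using norm_mult[of I I] imag_units_sq[of I] 
  by (metis abs_norm_cancel norm_minus_cancel norm_one power2_eq_square real_sqrt_abs real_sqrt_one)

lemma Quat_i_imag_unit: "Quat 0 1 0 0 \<in> imag_units"
  by (simp add: imag_units_def power2_eq_square quat_eq_iff)

lemma slice_emb_add: "slice_emb I (z + w) = slice_emb I z + slice_emb I w"
  by (simp add: slice_emb_def slice_point_def algebra_simps)

lemma slice_emb_of_real [simp]: "slice_emb I (of_real x) = of_real x"
  by (simp add: slice_emb_def slice_point_def)

lemma slice_emb_scaleR: "slice_emb I (x *\<^sub>R z) = x *\<^sub>R slice_emb I z"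
  by (simp add: slice_emb_def slice_point_def quat_eq_iff algebra_simps)

lemma slice_emb_one [simp]: "slice_emb I 1 = 1"
  by (simp add: slice_emb_def slice_point_def)

lemma slice_emb_sum: "slice_emb I (sum g A) = (\<Sum>n\<in>A. slice_emb I (g n))"
proof -
  have "slice_emb I 0 = 0"
    by (simp add: slice_emb_def slice_point_def)
  then show ?thesis
    by (induction A rule: infinite_finite_induct) (simp_all add: slice_emb_add)
qed

lemma slice_emb_mult:
  assumes "I \<in> imag_units"
  shows "slice_emb I (z * w) = slice_emb I z * slice_emb I w"
proof -
  have "(of_real x * I) * (of_real y * I) = - of_real (x * y)" for x y
    using imag_units_sq[OF assms] by (simp add: of_real_def)
  then show ?thesis
    by (simp add: slice_emb_def slice_point_def of_real_def algebra_simps imag_units_sq[OF assms])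
qed

lemma slice_emb_power:
  "I \<in> imag_units \<Longrightarrow> slice_emb I (z ^ n) = slice_emb I z ^ n"
  by (induction n) (simp_all add: slice_emb_mult)

lemma slice_emb_norm:
  assumes "I \<in> imag_units"
  shows "norm (slice_emb I z) = cmod z"
proof -
  have "(q1 I)\<^sup>2 + (q2 I)\<^sup>2 + (q3 I)\<^sup>2 = 1"
    using imag_units_norm[OF assms] imag_units_q0[OF assms] by (simp add: norm_quat)
  then have "(Im z)\<^sup>2 * ((q1 I)\<^sup>2 + (q2 I)\<^sup>2 + (q3 I)\<^sup>2) = (Im z)\<^sup>2"
    by simp
  then show ?thesis
    by (simp add: norm_quat cmod_def slice_emb_def slice_point_def imag_units_q0[OF assms]
        power_mult_distrib algebra_simps)
qed

lemma slice_emb_surj: "\<exists>I\<in>imag_units. \<exists>z. q = slice_emb I z"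
proof -
  define v where "v = q - of_real (q0 q)"
  show ?thesis
  proof (cases "v = 0")
    case True
    then have "q = slice_emb (Quat 0 1 0 0) (of_real (q0 q))"
      by (simp add: v_def)
    then show ?thesis
      using Quat_i_imag_unit by blast
  next
    case False
    define I where "I = v /\<^sub>R norm v"
    have "I * I = (inverse (norm v))\<^sup>2 *\<^sub>R (v * v)"
      by (simp add: I_def power2_eq_square)
    also have "v * v = - of_real ((norm v)\<^sup>2)"
      by (simp add: quat_eq_iff norm_quat v_def power2_eq_square)
    also have "(inverse (norm v))\<^sup>2 *\<^sub>R (- of_real ((norm v)\<^sup>2)) = (- 1 :: quat)"
      using False by (simp add: of_real_def field_simps)
    finally have "I \<in> imag_units"
      by (simp add: imag_units_def power2_eq_square)
    moreover have "q = slice_emb I (Complex (q0 q) (norm v))"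
      using False by (simp add: slice_emb_def slice_point_def I_def of_real_def[of "norm v"])
        (simp add: v_def)
    ultimately show ?thesis
      by blast
  qed
qed

section \<open>Cauchy estimates for quaternionic coefficients\<close>

text \<open>
  For an imaginary unit \<open>I\<close>, left multiplication by the slice of \<open>I\<close> makes the quaternions a complex vector space. The
  functional below is the complex linear one whose real part is the real functional \<open>q \<mapsto> w \<bullet> q\<close>;
  its norm is \<open>|w|\<close>. It reduces statements about quaternion-valued functions to complex-valued ones.
\<close>

definition slice_functional :: "quat \<Rightarrow> quat \<Rightarrow> quat \<Rightarrow> complex"
  where "slice_functional I w q = Complex (inner w q) (- inner w (I * q))"

lemma slice_functional_mult:
  assumes "I \<in> imag_units"
  shows "slice_functional I w (slice_emb I z * q) = z * slice_functional I w q"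
proof -
  have "slice_emb I z * q = Re z *\<^sub>R q + Im z *\<^sub>R (I * q)"
    by (simp add: slice_emb_def slice_point_def of_real_def algebra_simps)
  moreover have "I * (slice_emb I z * q) = Re z *\<^sub>R (I * q) - Im z *\<^sub>R q"
    using imag_units_sq[OF assms]
    by (simp add: calculation algebra_simps mult.assoc[symmetric])
  ultimately show ?thesis
    by (simp add: slice_functional_def complex_eq_iff inner_add_right inner_diff_right)
qed

lemma slice_functional_norm_le:
  assumes "I \<in> imag_units"
  shows "cmod (slice_functional I w q) \<le> norm w * norm q"
proof -
  let ?l = "slice_functional I w"
  define e where "e = cnj (sgn (?l q))"
  have e: "e * ?l q = of_real (cmod (?l q))"
  proof (cases "?l q = 0")
    case False
    have "e * ?l q = (cnj (?l q) * ?l q) /\<^sub>R cmod (?l q)"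
      by (simp add: e_def sgn_div_norm)
    also have "cnj (?l q) * ?l q = of_real ((cmod (?l q))\<^sup>2)"
      by (metis complex_norm_square mult.commute)
    also have "of_real ((cmod (?l q))\<^sup>2) /\<^sub>R cmod (?l q) = (of_real (cmod (?l q)) :: complex)"
      using False by (simp add: scaleR_conv_of_real power2_eq_square)
    finally show ?thesis .
  qed simp
  have "cmod (?l q) = Re (?l (slice_emb I e * q))"
    by (simp add: slice_functional_mult[OF assms] e)
  also have "\<dots> = inner w (slice_emb I e * q)"
    by (simp add: slice_functional_def)
  also have "\<dots> \<le> norm w * norm (slice_emb I e * q)"
    by (rule norm_cauchy_schwarz)
  also have "\<dots> = norm w * (cmod e * norm q)"
    by (simp add: norm_mult slice_emb_norm[OF assms])
  also have "\<dots> \<le> norm w * (1 * norm q)"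
    by (intro mult_left_mono mult_right_mono) (simp_all add: e_def norm_sgn)
  finally show ?thesis
    by simp
qed

lemma bounded_linear_slice_functional:
  assumes "I \<in> imag_units"
  shows "bounded_linear (slice_functional I w)"
proof (rule bounded_linear_intro)
  show "cmod (slice_functional I w q) \<le> norm q * norm w" for q
    using slice_functional_norm_le[OF assms, of w q] by (simp add: mult.commute)
qed (simp_all add: slice_functional_def complex_eq_iff algebra_simps inner_add_right)

text \<open>
  Only the values of \<open>\<Sum>n. q\<^sup>n c\<^sub>n\<close> on one slice are bounded, but the coefficients are arbitrary
  quaternions. The functional with \<open>w = c\<^sub>n\<close> turns the series into a complex power series whose \<open>n\<close>-th
  coefficient has real part \<open>|c\<^sub>n|\<^sup>2\<close>, so the classical Cauchy inequality applies without loss.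
\<close>

lemma slice_cauchy_estimate:
  assumes I: "I \<in> imag_units" and "0 < t" "t < s"
    and sums: "\<And>z. cmod z < s \<Longrightarrow> (\<lambda>n. slice_emb I z ^ n * c n) sums G z"
    and bound: "\<And>z. cmod z = t \<Longrightarrow> norm (G z) \<le> B"
  shows "norm (c n) \<le> B / t ^ n"
proof (cases "c n = 0")
  case True
  have "0 \<le> norm (G (of_real t))"
    by simp
  also have "\<dots> \<le> B"
    using \<open>0 < t\<close> by (intro bound) simp
  finally show ?thesis
    using True \<open>0 < t\<close> by simp
next
  case False
  define l where "l = slice_functional I (c n)"
  define F where "F = Abs_fps (\<lambda>n. l (c n))"
  have F: "(\<lambda>k. fps_nth F k * z ^ k) sums l (G z)" if "cmod z < s" for z
  proof -
    have "(\<lambda>k. l (slice_emb I z ^ k * c k)) sums l (G z)"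
      unfolding l_def
      by (intro bounded_linear.sums[OF bounded_linear_slice_functional] I sums that)
    then show ?thesis
      by (simp add: l_def F_def slice_functional_mult[OF I] mult.commute
          flip: slice_emb_power[OF I])
  qed
  have radius: "ereal s \<le> fps_conv_radius F"
    unfolding fps_conv_radius_def
    by (rule conv_radius_geI_ex') (use F \<open>0 < t\<close> \<open>t < s\<close> in \<open>auto simp: sums_iff\<close>)
  have eval: "eval_fps F z = l (G z)" if "cmod z < s" for z
    using F[OF that] by (simp add: eval_fps_def sums_iff)
  have "ereal t < fps_conv_radius F"
    by (rule less_le_trans[OF _ radius]) (simp add: \<open>t < s\<close>)
  then have sub: "cball 0 t \<subseteq> eball 0 (fps_conv_radius F)"
    by (metis ereal_less_eq(3) in_eball_iff le_less_trans mem_cball subsetI)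
  have hol: "eval_fps F holomorphic_on cball 0 t"
    using sub by (intro holomorphic_on_eval_fps) auto
  have "cmod ((deriv ^^ n) (eval_fps F) 0) \<le> fact n * (norm (c n) * B) / t ^ n"
  proof (rule Cauchy_inequality)
    show "eval_fps F holomorphic_on ball 0 t"
      using hol ball_subset_cball by (rule holomorphic_on_subset)
    show "continuous_on (cball 0 t) (eval_fps F)"
      using hol by (rule holomorphic_on_imp_continuous_on)
    show "cmod (eval_fps F z) \<le> norm (c n) * B" if "cmod (0 - z) = t" for z
    proof -
      have "cmod (eval_fps F z) \<le> norm (c n) * norm (G z)"
        using that \<open>t < s\<close> slice_functional_norm_le[OF I, of "c n" "G z"]
        by (simp add: eval l_def)
      also have "\<dots> \<le> norm (c n) * B"
        using that by (intro mult_left_mono bound) auto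
      finally show ?thesis .
    qed
  qed (fact \<open>0 < t\<close>)
  moreover have "l (c n) = (deriv ^^ n) (eval_fps F) 0 / fact n"
  proof -
    have "0 < fps_conv_radius F"
      using radius \<open>0 < t\<close> \<open>t < s\<close> by (auto intro: less_le_trans[of _ "ereal s"])
    from fps_nth_conv_deriv[OF this, of n] show ?thesis
      by (simp add: F_def)
  qed
  ultimately have "cmod (l (c n)) \<le> norm (c n) * B / t ^ n"
    by (simp only: norm_divide norm_fact) (simp add: divide_le_eq mult_ac)
  moreover have "norm (c n) * norm (c n) \<le> cmod (l (c n))"
    using complex_Re_le_cmod[of "l (c n)"]
    by (simp add: l_def slice_functional_def dot_square_norm power2_eq_square)
  ultimately have "norm (c n) * norm (c n) \<le> norm (c n) * (B / t ^ n)"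
    by simp
  then show ?thesis
    using False by (metis mult_le_cancel_left_pos zero_less_norm_iff)
qed

section \<open>Quaternionic power series\<close>

text \<open>
  The series \<open>\<Sum>n. q\<^sup>n c\<^sub>n\<close> converges absolutely on the open ball of radius \<open>R\<close> around \<open>0\<close>; this depends
  on the norms of the coefficients only.
\<close>

definition abs_conv :: "real \<Rightarrow> (nat \<Rightarrow> quat) \<Rightarrow> bool"
  where "abs_conv R c \<longleftrightarrow> (\<forall>s. 0 \<le> s \<longrightarrow> s < R \<longrightarrow> summable (\<lambda>n. s ^ n * norm (c n)))"

text \<open>
  The function given by a power series with coefficients on the right.
\<close>

definition quat_series :: "(nat \<Rightarrow> quat) \<Rightarrow> quat \<Rightarrow> quat"
  where "quat_series c q = (\<Sum>n. q ^ n * c n)"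

lemma abs_convI:
  assumes "\<And>q. q \<in> ball 0 R \<Longrightarrow> summable (\<lambda>n. q ^ n * c n)"
  shows "abs_conv R c"
  unfolding abs_conv_def
proof (intro allI impI)
  fix s :: real
  assume "0 \<le> s" "s < R"
  then obtain x where x: "s < x" "x < R"
    using dense by blast
  have "(of_real x :: quat) ^ n * c n = c n * of_real x ^ n" for n
    by (simp add: of_real_def)
  then have "summable (\<lambda>n. c n * of_real x ^ n)"
    using assms[of "of_real x"] x \<open>0 \<le> s\<close> by simp
  then have "summable (\<lambda>n. norm (c n * of_real s ^ n))"
    by (rule powser_insidea) (use x \<open>0 \<le> s\<close> in simp)
  then show "summable (\<lambda>n. s ^ n * norm (c n))"
    using \<open>0 \<le> s\<close> by (simp add: norm_mult norm_power mult.commute)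
qed

lemma abs_conv_summable_norm:
  assumes "abs_conv R c" "norm q < R"
  shows "summable (\<lambda>n. norm (q ^ n * c n))"
  using assms by (simp add: abs_conv_def norm_mult norm_power)

lemma abs_conv_sums:
  "abs_conv R c \<Longrightarrow> norm q < R \<Longrightarrow> (\<lambda>n. q ^ n * c n) sums quat_series c q"
  unfolding quat_series_def
  by (rule summable_sums[OF summable_norm_cancel[OF abs_conv_summable_norm]])

lemma quat_series_zero: "quat_series c 0 = c 0"
proof -
  have "(\<lambda>n. 0 ^ n * c n) sums (\<Sum>n\<in>{0}. 0 ^ n * c n)"
    by (rule sums_finite) (auto simp: power_0_left)
  then show ?thesis
    by (simp add: quat_series_def sums_iff)
qed

lemma quat_series_continuous:
  assumes "abs_conv R c"
  shows "continuous_on (ball 0 R) (quat_series c)"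
proof -
  have "continuous_on (cball 0 s) (quat_series c)" if "0 \<le> s" "s < R" for s
    unfolding quat_series_def
  proof (rule uniform_limit_theorem[OF _ Weierstrass_m_test])
    show "\<forall>\<^sub>F n in sequentially. continuous_on (cball 0 s) (\<lambda>q. \<Sum>i<n. q ^ i * c i)"
      by (intro always_eventually allI continuous_intros)
    show "summable (\<lambda>n. s ^ n * norm (c n))"
      using assms that by (simp add: abs_conv_def)
    show "norm (q ^ n * c n) \<le> s ^ n * norm (c n)" if "q \<in> cball 0 s" for n q
      using that by (simp add: norm_mult norm_power mult_right_mono power_mono)
  qed simp
  note on_cball = this
  show ?thesis
  proof (rule continuous_at_imp_continuous_on, rule ballI)
    fix q :: quat
    assume "q \<in> ball 0 R"
    then obtain s where s: "norm q < s" "s < R"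
      using dense by auto
    then have "continuous_on (ball 0 s) (quat_series c)"
      using on_cball[of s] norm_ge_zero[of q]
      by (meson ball_subset_cball continuous_on_subset less_imp_le order_trans)
    then show "isCont (quat_series c) q"
      using s by (simp add: continuous_on_eq_continuous_at)
  qed
qed

text \<open>
  The coefficients of the slice derivative of a power series.
\<close>

definition deriv_coeff :: "(nat \<Rightarrow> quat) \<Rightarrow> nat \<Rightarrow> quat"
  where "deriv_coeff c n = real (Suc n) *\<^sub>R c (Suc n)"

lemma abs_conv_deriv_coeff:
  assumes "abs_conv R c"
  shows "abs_conv R (deriv_coeff c)"
  unfolding abs_conv_def
proof (intro allI impI)
  fix s :: real
  assume s: "0 \<le> s" "s < R"
  have "summable (\<lambda>n. diffs (\<lambda>n. norm (c n)) n * s ^ n)"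
  proof (rule termdiff_converges)
    show "norm s < R"
      using s by simp
    show "summable (\<lambda>n. norm (c n) * x ^ n)" if "norm x < R" for x :: real
    proof (rule summable_norm_cancel)
      show "summable (\<lambda>n. norm (norm (c n) * x ^ n))"
        using assms that by (simp add: abs_conv_def abs_mult power_abs mult.commute[of "norm _"])
    qed
  qed
  then show "summable (\<lambda>n. s ^ n * norm (deriv_coeff c n))"
    by (simp add: deriv_coeff_def diffs_def mult_ac)
qed

lemma abs_conv_shift:
  assumes "abs_conv R c"
  shows "abs_conv R (\<lambda>n. c (Suc n))"
  unfolding abs_conv_def
proof (intro allI impI)
  fix s :: real
  assume s: "0 \<le> s" "s < R"
  have "norm (c (Suc n)) \<le> norm (deriv_coeff c n)" for n
    using mult_right_mono[of 1 "real (Suc n)" "norm (c (Suc n))"]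
    by (simp add: deriv_coeff_def del: of_nat_Suc)
  moreover have "summable (\<lambda>n. s ^ n * norm (deriv_coeff c n))"
    using abs_conv_deriv_coeff[OF assms] s by (simp add: abs_conv_def)
  moreover have "norm (s ^ n * norm (c (Suc n))) \<le> s ^ n * norm (deriv_coeff c n)" for n
    using mult_left_mono[OF calculation(1), of "s ^ n" n] s by simp
  ultimately show "summable (\<lambda>n. s ^ n * norm (c (Suc n)))"
    by (blast intro: summable_comparison_test')
qed

text \<open>
  The derivative at \<open>0\<close> in direction \<open>v\<close>: writing the series as \<open>c\<^sub>0 + q k(q)\<close> with \<open>k\<close> the shifted series,
  it suffices that \<open>k\<close> is continuous with \<open>k(0) = c\<^sub>1\<close>.
\<close>

lemma quat_series_has_vector_derivative:
  assumes "abs_conv R c" "R > 0"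
  shows "((\<lambda>t. quat_series c (of_real t * v)) has_vector_derivative v * c 1) (at 0)"
proof -
  define k where "k = quat_series (\<lambda>n. c (Suc n))"
  have factor: "quat_series c q = c 0 + q * k q" if "norm q < R" for q
  proof -
    have "(\<lambda>n. q * (q ^ n * c (Suc n))) sums (q * k q)"
      unfolding k_def by (intro sums_mult abs_conv_sums[OF abs_conv_shift[OF assms(1)] that])
    then have "(\<lambda>n. q ^ Suc n * c (Suc n)) sums (q * k q)"
      by (simp add: mult.assoc)
    then have "(\<lambda>n. q ^ n * c n) sums (q * k q + q ^ 0 * c 0)"
      by (rule sums_Suc)
    then show ?thesis
      using abs_conv_sums[OF assms(1) that] by (simp add: sums_unique2 add.commute)
  qed
  have small: "((\<lambda>h. of_real h * v) \<longlongrightarrow> 0) (at 0)"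
    by (rule tendsto_eq_intros refl)+ simp
  have "isCont k 0"
    using quat_series_continuous[OF abs_conv_shift[OF assms(1)]] \<open>R > 0\<close>
    by (simp add: k_def continuous_on_eq_continuous_at)
  then have "((\<lambda>h. k (of_real h * v)) \<longlongrightarrow> c 1) (at 0)"
    using isCont_tendsto_compose[OF _ small] by (force simp: k_def quat_series_zero)
  then have "((\<lambda>h. norm (v * (k (of_real h * v) - c 1))) \<longlongrightarrow> norm (v * (c 1 - c 1))) (at 0)"
    by (intro tendsto_intros)
  moreover have "\<forall>\<^sub>F h in at 0. norm (v * (k (of_real h * v) - c 1)) =
      norm (quat_series c (of_real h * v) - c 0 - h *\<^sub>R (v * c 1)) / norm h"
  proof -
    have "\<forall>\<^sub>F h in at 0. of_real h * v \<in> ball 0 R"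
      by (rule topological_tendstoD[OF small]) (use \<open>R > 0\<close> in auto)
    moreover have "\<forall>\<^sub>F h :: real in at 0. h \<noteq> 0"
      by (simp add: eventually_at_filter)
    ultimately show ?thesis
    proof eventually_elim
      case (elim h)
      have "quat_series c (of_real h * v) - c 0 - h *\<^sub>R (v * c 1) =
          h *\<^sub>R (v * (k (of_real h * v) - c 1))"
        using elim by (simp add: factor) (simp add: of_real_def algebra_simps)
      then show ?case
        using elim by simp
    qed
  qed
  ultimately have "((\<lambda>h. norm (quat_series c (of_real h * v) - c 0 - h *\<^sub>R (v * c 1)) / norm h)
      \<longlongrightarrow> 0) (at 0)"
    by (simp add: filterlim_cong)
  then show ?thesis
    by (simp add: has_vector_derivative_def has_derivative_at quat_series_zero
        bounded_linear_scaleR_left)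
qed

text \<open>
  At \<open>0\<close> every imaginary unit gives the value \<open>a\<^sub>1\<close>, since \<open>(a\<^sub>1 - I (I a\<^sub>1)) / 2 = a\<^sub>1\<close>; this determines the
  definite description in the slice derivative.
\<close>

lemma slice_deriv_quat_series_zero:
  assumes conv: "abs_conv R a" "R > 0"
    and f: "\<And>q. q \<in> ball 0 R \<Longrightarrow> f q = quat_series a q"
  shows "slice_deriv f 0 = a 1"
proof -
  have deriv: "vector_derivative (\<lambda>t. f (of_real t * v)) (at 0) = v * a 1" if "norm v = 1" for v
  proof (rule vector_derivative_at)
    show "((\<lambda>t. f (of_real t * v)) has_vector_derivative v * a 1) (at 0)"
      using quat_series_has_vector_derivative[OF conv]
      by (rule has_vector_derivative_transform_within_open[where S = "ball 0 R"])
        (use \<open>R > 0\<close> that in \<open>auto simp: f norm_mult\<close>)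
  qed
  have "slice_dx f I 0 0 = a 1" "slice_dy f I 0 0 = I * a 1" if "I \<in> imag_units" for I
    using deriv[of 1] deriv[OF imag_units_norm[OF that]]
    by (simp_all add: slice_dx_def slice_dy_def slice_point_def)
  then have "(1 / 2) *\<^sub>R (slice_dx f I 0 0 - I * slice_dy f I 0 0) = a 1"
    if "I \<in> imag_units" for I
    using that by (simp add: mult.assoc[symmetric] imag_units_sq flip: scaleR_2)
  moreover have "x = 0 \<and> y = 0" if "I \<in> imag_units" "0 = slice_point I x y" for I x y
    using slice_emb_norm[OF that(1), of "Complex x y"] that(2)[symmetric]
    by (simp add: slice_emb_def complex_eq_iff)
  moreover have "0 = slice_point I 0 0" for I
    by (simp add: slice_point_def)
  ultimately show ?thesis
    unfolding slice_deriv_def using Quat_i_imag_unit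
    by (intro the_equality) metis+
qed

section \<open>Expansion around a real point\<close>

text \<open>
  A quaternion and a real number lie on a common slice, so the complex binomial theorem applies.
\<close>

lemma binomial_of_real:
  fixes x :: quat
  shows "(x + of_real r) ^ k = (\<Sum>n\<le>k. (real (k choose n) * r ^ (k - n)) *\<^sub>R x ^ n)"
proof -
  obtain I z where I: "I \<in> imag_units" and x: "x = slice_emb I z"
    using slice_emb_surj by blast
  have "(x + of_real r) ^ k = slice_emb I ((z + of_real r) ^ k)"
    by (simp add: x slice_emb_power[OF I] slice_emb_add)
  also have "(z + of_real r) ^ k = (\<Sum>n\<le>k. (real (k choose n) * r ^ (k - n)) *\<^sub>R z ^ n)"
    by (simp add: binomial_ring scaleR_conv_of_real mult_ac)
  finally show ?thesis
    by (simp add: slice_emb_sum slice_emb_scaleR slice_emb_power[OF I] x)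
qed

text \<open>
  The coefficients of the expansion of \<open>\<Sum>k. q\<^sup>k c\<^sub>k\<close> in powers of \<open>q - r\<close> for real \<open>r\<close>. The truncated
  exponent \<open>k - n\<close> is harmless, as the binomial coefficient vanishes for \<open>n > k\<close>.
\<close>

definition recenter :: "real \<Rightarrow> (nat \<Rightarrow> quat) \<Rightarrow> nat \<Rightarrow> quat"
  where "recenter r c n = (\<Sum>k. (real (k choose n) * r ^ (k - n)) *\<^sub>R c k)"

lemma recenter_0: "recenter r c 0 = quat_series c (of_real r)"
  by (simp add: recenter_def quat_series_def scaleR_conv_of_real)

text \<open>
  For any \<open>y > 0\<close>, the term \<open>(k choose n) y\<^sup>n r\<^sup>k\<^sup>-\<^sup>n\<close> is one summand of \<open>(y + r)\<^sup>k\<close>, which bounds the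
  terms of the series by those of a convergent one if also \<open>y + r < R\<close>.
\<close>

lemma recenter_summable_norm:
  assumes conv: "abs_conv R c" and r: "0 \<le> r" "r < R"
  shows "summable (\<lambda>k. norm ((real (k choose n) * r ^ (k - n)) *\<^sub>R c k))"
proof -
  define y where "y = (R - r) / 2"
  have y: "0 < y" "y + r < R"
    using r by (auto simp: y_def field_simps)
  have "real (k choose n) * r ^ (k - n) \<le> inverse (y ^ n) * (y + r) ^ k" for k
  proof (cases "n \<le> k")
    case True
    then have "real (k choose n) * y ^ n * r ^ (k - n) \<le> (y + r) ^ k"
      unfolding binomial_ring using r y by (intro member_le_sum) auto
    then show ?thesis
      using y by (simp add: field_simps)
  qed (use r y in \<open>simp add: binomial_eq_0\<close>)
  then have "norm (norm ((real (k choose n) * r ^ (k - n)) *\<^sub>R c k))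
      \<le> inverse (y ^ n) * ((y + r) ^ k * norm (c k))" for k
    using r mult_right_mono[OF _ norm_ge_zero[of "c k"]] by (simp add: mult.assoc[symmetric])
  moreover have "summable (\<lambda>k. inverse (y ^ n) * ((y + r) ^ k * norm (c k)))"
    using conv y r by (intro summable_mult) (simp add: abs_conv_def)
  ultimately show ?thesis
    by (blast intro: summable_comparison_test')
qed

text \<open>
  Differentiation commutes with the change of centre, by the absorption identity
  \<open>(k + 1) (k choose n) = (n + 1) (k + 1 choose n + 1)\<close>.
\<close>

lemma recenter_deriv_coeff:
  assumes "abs_conv R c" "0 \<le> r" "r < R"
  shows "recenter r (deriv_coeff c) n = deriv_coeff (recenter r c) n"
proof -
  let ?g = "\<lambda>k. (real (k choose Suc n) * r ^ (k - Suc n)) *\<^sub>R c k"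
  have g: "summable ?g"
    by (rule summable_norm_cancel[OF recenter_summable_norm[OF assms]])
  have absorb: "real (k choose n) * real (Suc k) = real (Suc n) * real (Suc k choose Suc n)" for k
    by (metis Suc_times_binomial_eq mult.commute of_nat_mult)
  have "(real (k choose n) * r ^ (k - n)) *\<^sub>R deriv_coeff c k = real (Suc n) *\<^sub>R ?g (Suc k)" for k
  proof -
    have "real (k choose n) * r ^ (k - n) * real (Suc k) =
        real (Suc n) * (real (Suc k choose Suc n) * r ^ (k - n))"
      using arg_cong[OF absorb[of k], of "\<lambda>m. m * r ^ (k - n)"] by (simp only: mult_ac)
    then show ?thesis
      by (simp only: deriv_coeff_def scaleR_scaleR diff_Suc_Suc)
  qed
  then have "recenter r (deriv_coeff c) n = (\<Sum>k. real (Suc n) *\<^sub>R ?g (Suc k))"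
    by (simp only: recenter_def)
  also have "\<dots> = real (Suc n) *\<^sub>R (\<Sum>k. ?g (Suc k))"
    using g by (intro suminf_scaleR_right[symmetric]) (subst summable_Suc_iff)
  also have "(\<Sum>k. ?g (Suc k)) = recenter r c (Suc n)"
    using suminf_split_head[OF g] by (simp add: recenter_def)
  finally show ?thesis
    by (simp only: deriv_coeff_def[of "recenter r c"])
qed

text \<open>
  The double family \<open>F\<close> of the binomial expansion of all \<open>(x + r)\<^sup>k c\<^sub>k\<close> is absolutely summable, because
  the norms in row \<open>k\<close> add up to \<open>(|x| + r)\<^sup>k |c\<^sub>k|\<close>. Summing it by rows gives the series at \<open>x + r\<close>,
  summing it by columns gives the expansion in powers of \<open>x\<close>.
\<close>

lemma recenter_sums:
  assumes conv: "abs_conv R c" and "0 \<le> r" and x: "norm x + r < R"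
  shows "(\<lambda>n. x ^ n * recenter r c n) sums quat_series c (x + of_real r)"
proof -
  define F :: "quat \<Rightarrow> nat \<times> nat \<Rightarrow> quat"
    where "F = (\<lambda>x (k, n). (real (k choose n) * r ^ (k - n)) *\<^sub>R (x ^ n * c k))"
  have norm_row: "((\<lambda>n. norm (F x (k, n))) has_sum ((norm x + r) ^ k * norm (c k))) UNIV" for k x
  proof -
    have "((\<lambda>n. norm (F x (k, n))) has_sum (\<Sum>n\<le>k. norm (F x (k, n)))) UNIV"
      by (rule has_sum_finite_neutralI) (auto simp: F_def)
    also have "(\<Sum>n\<le>k. norm (F x (k, n))) = (norm x + r) ^ k * norm (c k)"
      using \<open>0 \<le> r\<close>
      by (simp add: F_def binomial_ring sum_distrib_left sum_distrib_right norm_mult norm_power mult_ac)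
    finally show ?thesis .
  qed
  have abs: "(\<lambda>p. norm (F x p)) summable_on UNIV \<times> UNIV" if "norm x + r < R" for x
  proof (rule summable_on_SigmaI)
    show "((\<lambda>n. norm (F x (k, n))) has_sum ((norm x + r) ^ k * norm (c k))) UNIV" for k
      by (rule norm_row)
    show "(\<lambda>k. (norm x + r) ^ k * norm (c k)) summable_on UNIV"
      using conv that \<open>0 \<le> r\<close> by (subst summable_on_UNIV_nonneg_real_iff) (auto simp: abs_conv_def)
  qed simp
  have row: "((\<lambda>n. F x (k, n)) has_sum ((x + of_real r) ^ k * c k)) UNIV" for k
  proof -
    have "((\<lambda>n. F x (k, n)) has_sum (\<Sum>n\<le>k. F x (k, n))) UNIV"
      by (rule has_sum_finite_neutralI) (auto simp: F_def)
    also have "(\<Sum>n\<le>k. F x (k, n)) = (x + of_real r) ^ k * c k"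
      by (simp add: F_def binomial_of_real sum_distrib_right)
    finally show ?thesis .
  qed
  have column: "((\<lambda>k. F x (k, n)) has_sum (x ^ n * recenter r c n)) UNIV" for n
  proof -
    have *: "summable (\<lambda>k. norm ((real (k choose n) * r ^ (k - n)) *\<^sub>R c k))"
      using x norm_ge_zero[of x] \<open>0 \<le> r\<close> by (intro recenter_summable_norm[OF conv]) linarith+
    have "((\<lambda>k. (real (k choose n) * r ^ (k - n)) *\<^sub>R c k) has_sum recenter r c n) UNIV"
      unfolding recenter_def
      by (rule norm_summable_imp_has_sum[OF * summable_sums[OF summable_norm_cancel[OF *]]])
    then have "((\<lambda>k. x ^ n * ((real (k choose n) * r ^ (k - n)) *\<^sub>R c k)) has_sum
        (x ^ n * recenter r c n)) UNIV"
      by (rule has_sum_cmult_right)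
    then show ?thesis
      by (simp add: F_def)
  qed
  have total: "(F x has_sum infsum (F x) (UNIV \<times> UNIV)) (UNIV \<times> UNIV)"
    by (rule has_sum_infsum[OF abs_summable_summable[OF abs[OF x]]])
  have rows: "((\<lambda>k. (x + of_real r) ^ k * c k) has_sum infsum (F x) (UNIV \<times> UNIV)) UNIV"
    using has_sum_SigmaD[OF total row] .
  have "((\<lambda>(n, k). F x (k, n)) has_sum infsum (F x) (UNIV \<times> UNIV)) (UNIV \<times> UNIV)"
    using total by (subst (asm) has_sum_swap)
  then have columns:
      "((\<lambda>n. x ^ n * recenter r c n) has_sum infsum (F x) (UNIV \<times> UNIV)) UNIV"
    by (rule has_sum_SigmaD) (simp add: column)
  have "norm (x + of_real r) < R"
    using norm_triangle_ineq[of x "of_real r"] x \<open>0 \<le> r\<close> by simp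
  from abs_conv_sums[OF conv this] have "infsum (F x) (UNIV \<times> UNIV) = quat_series c (x + of_real r)"
    using has_sum_imp_sums[OF rows] by (rule sums_unique2[symmetric])
  with has_sum_imp_sums[OF columns] show ?thesis
    by simp
qed

section \<open>Covering a ball\<close>

text \<open>
  A quantitative surjectivity statement for maps close to \<open>q \<mapsto> g z + (q - z) b\<close>: a solution of
  \<open>g q = w\<close> is a fixed point of the simplified Newton map \<open>T\<close>, which maps the closed ball to itself.
\<close>

lemma ball_subset_image_near_linear:
  fixes g :: "quat \<Rightarrow> quat"
  assumes "\<rho> > 0" "b \<noteq> 0"
    and cont: "continuous_on (cball z \<rho>) g"
    and near: "\<And>q. q \<in> cball z \<rho> \<Longrightarrow> norm (g q - g z - (q - z) * b) \<le> e"
    and small: "\<delta> + e \<le> norm b * \<rho>"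
  shows "ball (g z) \<delta> \<subseteq> g ` cball z \<rho>"
proof
  fix w
  assume w: "w \<in> ball (g z) \<delta>"
  define T where "T q = q - (g q - w) * inverse b" for q
  have "continuous_on (cball z \<rho>) T"
    unfolding T_def by (intro continuous_intros cont)
  moreover have "T q \<in> cball z \<rho>" if "q \<in> cball z \<rho>" for q
  proof -
    have "T q - z = ((w - g z) - (g q - g z - (q - z) * b)) * inverse b"
      using \<open>b \<noteq> 0\<close> by (simp add: T_def algebra_simps mult.assoc)
    then have "norm (T q - z) = norm ((w - g z) - (g q - g z - (q - z) * b)) / norm b"
      by (simp only: norm_mult norm_inverse divide_inverse)
    also have "\<dots> \<le> (\<delta> + e) / norm b"
      using norm_triangle_ineq4[of "w - g z" "g q - g z - (q - z) * b"] near[OF that] w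
      by (intro divide_right_mono) (auto simp: dist_norm norm_minus_commute)
    also have "\<dots> \<le> \<rho>"
      using small \<open>b \<noteq> 0\<close> by (simp add: field_simps)
    finally show ?thesis
      by (simp add: dist_norm norm_minus_commute)
  qed
  ultimately obtain q where q: "q \<in> cball z \<rho>" "T q = q"
    using brouwer_ball[OF \<open>\<rho> > 0\<close>] by blast
  then have "(g q - w) * inverse b = 0"
    by (simp add: T_def)
  then have "w = g q"
    using \<open>b \<noteq> 0\<close> by simp
  with q show "w \<in> g ` cball z \<rho>"
    by blast
qed

text \<open>
  The derivative need only be bounded at distance \<open>t\<close> from \<open>r\<close> on one slice, but the conclusion is
  about balls in the whole space of quaternions.
\<close>

lemma quat_series_covers_ball:
  assumes conv: "abs_conv R c" and r: "0 \<le> r" and t: "0 < t" "r + t < R"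
    and I: "I \<in> imag_units"
    and B: "B = norm (quat_series (deriv_coeff c) (of_real r))" "B > 0"
    and bound: "\<And>z. cmod z = t \<Longrightarrow>
      norm (quat_series (deriv_coeff c) (slice_emb I z + of_real r)) \<le> 2 * B"
  shows "ball (quat_series c (of_real r)) (t * B * (5 - 2 * sqrt 6))
    \<subseteq> quat_series c ` ball (of_real r) t"
proof -
  define b where "b = recenter r c"
  have at_r: "b 0 = quat_series c (of_real r)"
    by (simp add: b_def recenter_0)
  have conv': "abs_conv R (deriv_coeff c)"
    using conv by (rule abs_conv_deriv_coeff)
  have shift: "recenter r (deriv_coeff c) = deriv_coeff b"
    using recenter_deriv_coeff[OF conv r] t by (auto simp: b_def)
  have B_eq: "B = norm (b 1)"
  proof -
    have "deriv_coeff b 0 = quat_series (deriv_coeff c) (of_real r)"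
      by (simp add: shift[symmetric] recenter_0)
    then show ?thesis
      by (simp add: B deriv_coeff_def)
  qed
  have coeff: "norm (b (Suc n)) \<le> 2 * B / t ^ n" for n
  proof -
    have "norm (deriv_coeff b n) \<le> 2 * B / t ^ n"
    proof (rule slice_cauchy_estimate[OF I \<open>0 < t\<close>])
      show "t < R - r"
        using t by simp
      show "(\<lambda>n. slice_emb I z ^ n * deriv_coeff b n) sums
          quat_series (deriv_coeff c) (slice_emb I z + of_real r)" if "cmod z < R - r" for z
        using recenter_sums[OF conv' r, of "slice_emb I z"] that
        by (simp add: shift slice_emb_norm[OF I])
    qed (fact bound)
    moreover have "norm (b (Suc n)) \<le> norm (deriv_coeff b n)"
      using mult_right_mono[of 1 "real (Suc n)" "norm (b (Suc n))"]
      by (simp add: deriv_coeff_def del: of_nat_Suc)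
    ultimately show ?thesis
      by simp
  qed
  \<comment> \<open>The maximiser of \<open>x - 2 x\<^sup>2 / (1 - x)\<close> on the unit interval: there \<open>(1 - x)\<^sup>2 = 2 / 3\<close>.\<close>
  define x where "x = 1 - sqrt 6 / 3"
  have "sqrt 6 < 3"
    by (rule real_less_lsqrt) simp_all
  then have x: "0 < x" "x < 1"
    by (simp_all add: x_def)
  have optimum: "x - 2 * x\<^sup>2 / (1 - x) = 5 - 2 * sqrt 6"
    by (simp add: x_def power2_eq_square field_simps)
  define e where "e = 2 * B * t * x\<^sup>2 / (1 - x)"
  have near: "norm (quat_series c q - b 0 - (q - of_real r) * b 1) \<le> e"
    if q: "q \<in> cball (of_real r) (t * x)" for q
  proof -
    define y where "y = q - of_real r"
    have y: "norm y \<le> t * x"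
      using q by (simp add: y_def dist_norm norm_minus_commute)
    also have "t * x < t"
      using x t by simp
    finally have "(\<lambda>n. y ^ n * b n) sums quat_series c q"
      using recenter_sums[OF conv r, of y] t by (simp add: b_def y_def)
    then have "(\<lambda>n. y ^ (n + 2) * b (n + 2)) sums
        (quat_series c q - (\<Sum>n<2. y ^ n * b n))"
      by (rule sums_split_initial_segment)
    moreover have "(\<lambda>n. 2 * B * t * x\<^sup>2 * x ^ n) sums (2 * B * t * x\<^sup>2 * (1 / (1 - x)))"
      using x by (intro sums_mult geometric_sums) simp
    moreover have "norm (y ^ (n + 2) * b (n + 2)) \<le> 2 * B * t * x\<^sup>2 * x ^ n" for n
    proof -
      have "norm (y ^ (n + 2) * b (n + 2)) \<le> (t * x) ^ (n + 2) * (2 * B / t ^ (n + 1))"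
        unfolding norm_mult norm_power using coeff[of "n + 1"] y x t
        by (intro mult_mono power_mono) auto
      also have "\<dots> = 2 * B * t * x\<^sup>2 * x ^ n"
        using t by (simp add: power_mult_distrib power2_eq_square)
      finally show ?thesis .
    qed
    ultimately have "norm (quat_series c q - (\<Sum>n<2. y ^ n * b n))
        \<le> 2 * B * t * x\<^sup>2 * (1 / (1 - x))"
      by (rule norm_sums_le)
    then show ?thesis
      by (simp add: numeral_2_eq_2 y_def e_def algebra_simps)
  qed
  have "ball (quat_series c (of_real r)) (t * B * (5 - 2 * sqrt 6))
      \<subseteq> quat_series c ` cball (of_real r) (t * x)"
  proof (rule ball_subset_image_near_linear)
    show "b 1 \<noteq> 0"
      using B B_eq by auto
    show "norm (quat_series c q - quat_series c (of_real r) - (q - of_real r) * b 1) \<le> e"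
      if "q \<in> cball (of_real r) (t * x)" for q
      using near[OF that] by (simp add: at_r)
    have "t * x < t"
      using x t by simp
    have "cball (of_real r) (t * x) \<subseteq> (ball 0 R :: quat set)"
    proof
      fix q :: quat
      assume "q \<in> cball (of_real r) (t * x)"
      then show "q \<in> ball 0 R"
        using norm_triangle_ineq2[of q "of_real r"] r t \<open>t * x < t\<close>
        unfolding mem_cball mem_ball dist_norm norm_minus_commute[of _ q]
        by (simp only: norm_of_real diff_zero abs_of_nonneg)
    qed
    then show "continuous_on (cball (of_real r) (t * x)) (quat_series c)"
      using quat_series_continuous[OF conv] by (rule continuous_on_subset[rotated])
    have "t * B * (5 - 2 * sqrt 6) + e = B * (t * x)"
      unfolding optimum[symmetric] e_def by (simp add: algebra_simps)
    then show "t * B * (5 - 2 * sqrt 6) + e \<le> norm (b 1) * (t * x)"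
      by (simp add: B_eq)
  qed (use x t in simp)
  also have "\<dots> \<subseteq> quat_series c ` ball (of_real r) t"
  proof (intro image_mono subsetI)
    have "t * x < t"
      using x t by simp
    then show "q \<in> ball (of_real r) t" if "q \<in> cball (of_real r) (t * x)" for q :: quat
      using that unfolding mem_ball mem_cball by (rule le_less_trans[rotated])
  qed
  finally show ?thesis .
qed

section \<open>The extremal point and the rotation\<close>

text \<open>
  The point \<open>p\<close> maximises \<open>(1 - |q|) |D(q)|\<close>; if \<open>|q| \<le> (1 + |p|) / 2\<close> then \<open>1 - |q|\<close> is at least
  \<open>(1 - |p|) / 2\<close>, whence the factor \<open>2\<close>.
\<close>

lemma exists_bloch_point:
  fixes D :: "quat \<Rightarrow> quat"
  assumes "continuous_on (cball 0 1) D" "norm (D 0) = 1"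
  obtains p where "norm p < 1" "1 \<le> (1 - norm p) * norm (D p)"
    "\<And>q. norm q \<le> (1 + norm p) / 2 \<Longrightarrow> norm (D q) \<le> 2 * norm (D p)"
proof -
  have "continuous_on (cball 0 1) (\<lambda>q. (1 - norm q) * norm (D q))"
    by (intro continuous_intros assms)
  then obtain p where p: "p \<in> cball 0 1"
    and max: "\<And>q. q \<in> cball 0 1 \<Longrightarrow> (1 - norm q) * norm (D q) \<le> (1 - norm p) * norm (D p)"
    using continuous_attains_sup[of "cball (0 :: quat) 1"] by force
  have ge1: "1 \<le> (1 - norm p) * norm (D p)"
    using max[of 0] assms by simp
  then have less: "norm p < 1"
    using p by (cases "norm p = 1") auto
  have "norm (D q) \<le> 2 * norm (D p)" if q: "norm q \<le> (1 + norm p) / 2" for q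
  proof -
    have "(1 - norm p) / 2 * norm (D q) \<le> (1 - norm q) * norm (D q)"
      using q by (intro mult_right_mono) (auto simp: field_simps)
    also have "\<dots> \<le> (1 - norm p) * norm (D p)"
      using q less by (intro max) auto
    finally have "(1 - norm p) * norm (D q) \<le> (1 - norm p) * (2 * norm (D p))"
      by simp
    then show ?thesis
      using less by simp
  qed
  with less ge1 show ?thesis
    by (rule that)
qed

text \<open>
  On a slice that contains \<open>u\<close>, where \<open>q\<close> and \<open>u\<close> commute, rotating the coefficients amounts to the substitution
  \<open>q \<mapsto> q u\<close>.
\<close>

lemma quat_series_deriv_rotation:
  assumes "abs_conv R (deriv_coeff a)" "norm u = 1" "norm q < R" "q * u = u * q"
  shows "quat_series (deriv_coeff (\<lambda>n. u ^ n * a n)) q = u * quat_series (deriv_coeff a) (q * u)"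
proof -
  have "(\<lambda>n. u * ((q * u) ^ n * deriv_coeff a n)) sums (u * quat_series (deriv_coeff a) (q * u))"
    using assms by (intro sums_mult abs_conv_sums) (auto simp: norm_mult)
  moreover have "u * ((q * u) ^ n * deriv_coeff a n) =
      q ^ n * deriv_coeff (\<lambda>n. u ^ n * a n) n" for n
  proof -
    have "u * q ^ k = q ^ k * u" for k
      using assms(4) by (metis power_commuting_commutes)
    note commute = this
    have "u * (q * u) ^ n = q ^ n * u ^ Suc n"
    proof (induction n)
      case (Suc n)
      have "u * (q * u) ^ Suc n = (u * q) * (u * (q * u) ^ n)"
        by (simp add: mult.assoc)
      also have "\<dots> = q * (u * q ^ n) * u ^ Suc n"
        by (simp only: Suc assms(4)[symmetric] mult.assoc)
      also have "\<dots> = q ^ Suc n * u ^ Suc (Suc n)"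
        by (simp only: commute power_Suc mult.assoc)
      finally show ?case .
    qed simp
    then show ?thesis
      by (simp add: deriv_coeff_def mult.assoc[symmetric])
  qed
  ultimately show ?thesis
    by (simp add: quat_series_def sums_iff)
qed

theorem theorem1p5:
  fixes f :: "quat \<Rightarrow> quat" and a :: "nat \<Rightarrow> quat" and R :: real
  assumes "R > 1"
    and "slice_regular_on (ball 0 R) f"
    and "\<And>q. q \<in> ball 0 R \<Longrightarrow> (\<lambda>n. q ^ n * a n) sums f q"
    and "slice_deriv f 0 = 1"
  shows "\<exists>u \<in> frontier (ball 0 1). \<exists>c.
    ball c (5 / 2 - sqrt 6) \<subseteq> slice_rotation a u ` ball 0 1"
proof -
  have conv: "abs_conv R a"
    using assms(3) by (intro abs_convI) (auto simp: sums_iff)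
  then have conv': "abs_conv R (deriv_coeff a)"
    by (rule abs_conv_deriv_coeff)
  define D where "D = quat_series (deriv_coeff a)"
  have "a 1 = 1"
    using slice_deriv_quat_series_zero[OF conv, of f] assms by (simp add: quat_series_def sums_iff)
  then have "norm (D 0) = 1"
    by (simp add: D_def quat_series_zero deriv_coeff_def)
  moreover have "continuous_on (cball 0 1) D"
    unfolding D_def using quat_series_continuous[OF conv']
    by (rule continuous_on_subset) (use \<open>R > 1\<close> in auto)
  ultimately obtain p where p: "norm p < 1" "1 \<le> (1 - norm p) * norm (D p)"
    and Dp: "\<And>q. norm q \<le> (1 + norm p) / 2 \<Longrightarrow> norm (D q) \<le> 2 * norm (D p)"
    using exists_bloch_point by metis
  obtain I z where I: "I \<in> imag_units" and z: "p = slice_emb I z"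
    using slice_emb_surj by blast
  define r where "r = cmod z"
  \<comment> \<open>If \<open>p = 0\<close>, every direction may serve as \<open>u\<close>.\<close>
  define \<zeta> where "\<zeta> = (if z = 0 then 1 else sgn z)"
  define u where "u = slice_emb I \<zeta>"
  have r: "0 \<le> r" "r < 1" "norm p = r"
    using p by (simp_all add: r_def z slice_emb_norm[OF I])
  have "cmod \<zeta> = 1"
    by (simp add: \<zeta>_def norm_sgn)
  then have u: "norm u = 1"
    by (simp add: u_def slice_emb_norm[OF I])
  have "z = of_real r * \<zeta>"
    by (simp add: r_def \<zeta>_def sgn_div_norm scaleR_conv_of_real)
  then have p_eq: "p = of_real r * u"
    by (simp add: z u_def slice_emb_mult[OF I])
  define t where "t = (1 - r) / 2"
  have t: "0 < t" "r + t < 1"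
    using r by (simp_all add: t_def field_simps)
  define c where "c = (\<lambda>n. u ^ n * a n)"
  have conv_c: "abs_conv R c"
    using conv u by (simp add: abs_conv_def c_def norm_mult norm_power)
  have rotated: "norm (quat_series (deriv_coeff c) (slice_emb I w)) =
      norm (D (slice_emb I w * u))" if "cmod w < R" for w
  proof -
    have "slice_emb I w * u = u * slice_emb I w"
      by (simp add: u_def mult.commute flip: slice_emb_mult[OF I])
    then show ?thesis
      using quat_series_deriv_rotation[OF conv' u] that
      by (simp add: c_def D_def slice_emb_norm[OF I] norm_mult u)
  qed
  define B where "B = norm (D p)"
  have B: "B = norm (quat_series (deriv_coeff c) (of_real r))"
    using rotated[of "of_real r"] r \<open>R > 1\<close> by (simp add: B_def p_eq)
  have "1 \<le> (1 - r) * B"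
    using p r by (simp add: B_def)
  then have tB: "1 / 2 \<le> t * B"
    by (simp add: t_def)
  have "B > 0"
    using \<open>1 \<le> (1 - r) * B\<close> by (cases "D p = 0") (auto simp: B_def)
  have "norm (quat_series (deriv_coeff c) (slice_emb I w + of_real r)) \<le> 2 * B"
    if "cmod w = t" for w
  proof -
    have le: "cmod (w + of_real r) \<le> (1 + r) / 2"
      using norm_triangle_ineq[of w "of_real r"] that r by (simp add: t_def field_simps)
    then have "norm (quat_series (deriv_coeff c) (slice_emb I (w + of_real r))) =
        norm (D (slice_emb I (w + of_real r) * u))"
      using r \<open>R > 1\<close> by (intro rotated) simp
    also have "\<dots> \<le> 2 * B"
      unfolding B_def using le by (intro Dp) (simp add: norm_mult u r slice_emb_norm[OF I])
    finally show ?thesis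
      by (simp add: slice_emb_add)
  qed
  then have cover: "ball (quat_series c (of_real r)) (t * B * (5 - 2 * sqrt 6))
      \<subseteq> quat_series c ` ball (of_real r) t"
    using quat_series_covers_ball[OF conv_c r(1) t(1) _ I B \<open>B > 0\<close>] t \<open>R > 1\<close> by simp
  have "sqrt 6 < 5 / 2"
    by (rule real_less_lsqrt) (simp_all add: power2_eq_square)
  then have "1 / 2 * (5 - 2 * sqrt 6) \<le> t * B * (5 - 2 * sqrt 6)"
    by (intro mult_right_mono tB) simp
  then have "5 / 2 - sqrt 6 \<le> t * B * (5 - 2 * sqrt 6)"
    by (simp add: diff_divide_distrib)
  then have "ball (quat_series c (of_real r)) (5 / 2 - sqrt 6)
      \<subseteq> ball (quat_series c (of_real r)) (t * B * (5 - 2 * sqrt 6))"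
    by (rule subset_ball)
  also note cover
  also have "quat_series c ` ball (of_real r) t \<subseteq> quat_series c ` ball 0 1"
  proof (intro image_mono subsetI)
    fix q :: quat
    assume "q \<in> ball (of_real r) t"
    then show "q \<in> ball 0 1"
      using norm_triangle_ineq2[of q "of_real r"] r t
      by (simp add: dist_norm norm_minus_commute)
  qed
  also have "quat_series c = slice_rotation a u"
    by (simp add: fun_eq_iff quat_series_def slice_rotation_def c_def mult.assoc)
  finally show ?thesis
    using u by (intro bexI[of _ u] exI) auto
qed

end
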